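(* For every function $f:\mathbb{N}\rightarrow\mathbb{N}$ there is a digraph $D$ with $|V(D)|=2^{\aleph_0}$ and uncountable dichromatic number such that for every $n\in\mathbb{N}$, every subdigraph of $D$ with dichromatic number $n+2$ has at least $f(n)$ vertices.
   Context: A digraph $D$ consists of a vertex set $V(D)$ and a set of ordered pairs $uv$ of vertices with $u\neq v$ (no loops). A directed cycle of length $n\geq 2$ is a digraph of the form $\{v_0v_1,v_1v_2,\dots,v_{n-1}v_0\}$ with the $v_i$ pairwise distinct. A colouring of $V(D)$ is chromatic if no directed cycle of $D$ is monochromatic. The dichromatic number $\chi(D)$ is the smallest cardinal $\kappa$ such that $D$ admits a chromatic colouring with $\kappa$ colours. A digraph is $k$-dichromatic if its dichromatic number is $k$; "uncountably dichromatic" means the dichromatic number is uncountable. *)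

theory Defs
  imports "HOL-Library.FuncSet" "Graph_Theory.Graph_Theory"
begin

unbundle cardinal_syntax

text \<open>
  Digraphs are loopfree pair digraphs of arbitrary cardinality (\<^locale>\<open>pair_loopfree_digraph\<close>;
  the locale \<^locale>\<open>digraph\<close> also requires finiteness). In \<^const>\<open>pre_digraph.cycle\<close> a loop
  is a cycle of length one, hence the explicit lower bound on the length.
\<close>

definition directed_cycle :: "'a pair_pre_digraph \<Rightarrow> ('a \<times> 'a) awalk \<Rightarrow> bool" where
  "directed_cycle D p \<longleftrightarrow> pre_digraph.cycle (with_proj D) p \<and> 2 \<le> length p"

definition monochromatic :: "('a \<Rightarrow> 'k) \<Rightarrow> ('a \<times> 'a) awalk \<Rightarrow> bool" where
  "monochromatic c p \<longleftrightarrow> (\<exists>k. \<forall>e\<in>set p. c (fst e) = k \<and> c (snd e) = k)"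

definition chromatic_colouring :: "'a pair_pre_digraph \<Rightarrow> 'k set \<Rightarrow> ('a \<Rightarrow> 'k) \<Rightarrow> bool" where
  "chromatic_colouring D K c \<longleftrightarrow>
     c \<in> pverts D \<rightarrow> K \<and> (\<forall>p. directed_cycle D p \<longrightarrow> \<not> monochromatic c p)"

definition chromatically_colourable :: "'a pair_pre_digraph \<Rightarrow> 'k rel \<Rightarrow> bool" where
  "chromatically_colourable D \<kappa> \<longleftrightarrow> (\<exists>c. chromatic_colouring D (Field \<kappa>) c)"

text \<open>
  Cardinals are well-orders \<open>\<kappa>\<close> with \<^term>\<open>Card_order \<kappa>\<close>, considered up to \<open>=o\<close>. Colouring the
  vertices by themselves is chromatic, so the least cardinal is attained among
  the cardinals on the vertex type; \<open>dichromatic_number_le\<close> below shows that it is least among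
  the cardinals on any type.
\<close>

definition dichromatic_number :: "'a pair_pre_digraph \<Rightarrow> 'a rel" where
  "dichromatic_number D = (SOME \<kappa>. Card_order \<kappa> \<and> chromatically_colourable D \<kappa> \<and>
     (\<forall>\<kappa>' :: 'a rel. Card_order \<kappa>' \<and> chromatically_colourable D \<kappa>' \<longrightarrow> \<kappa> \<le>o \<kappa>'))"

lemma (in pair_wf_digraph) chromatic_colouring_inj:
  assumes "inj_on c (pverts G)"
  shows "chromatic_colouring G (c ` pverts G) c"
  unfolding chromatic_colouring_def
proof (intro conjI allI impI notI)
  show "c \<in> pverts G \<rightarrow> c ` pverts G" by auto
next
  fix p assume p: "directed_cycle G p" and m: "monochromatic c p"
  from p obtain u where u: "awalk u p u" "distinct (tl (pawalk_verts u p))" "2 \<le> length p"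
    unfolding directed_cycle_def cycle_def by auto
  from u(3) obtain e1 e2 q where pe: "p = e1 # e2 # q"
    by (cases p; cases "tl p") auto
  have cas: "pcas u p u" and sub: "set p \<subseteq> parcs G"
    using u(1) by (auto simp: awalk_def)
  have last: "v \<in> set (pawalk_verts w es)" if "pcas w es v" for w v es
    using that by (induct es arbitrary: w) auto
  have e: "fst e1 = u" "snd e1 = fst e2" "pcas (snd e2) q u" using cas pe by auto
  have "fst e2 \<notin> set (pawalk_verts (snd e2) q)" using u(2) pe by simp
  with last[OF e(3)] have ne: "snd e1 \<noteq> fst e1" using e by auto
  have "e1 \<in> parcs G" using sub pe by simp
  then have "fst e1 \<in> pverts G" "snd e1 \<in> pverts G"
    by (rule arc_fst_in_verts, rule arc_snd_in_verts)
  moreover have "c (fst e1) = c (snd e1)" using m pe unfolding monochromatic_def by auto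
  ultimately show False using assms ne by (auto dest: inj_onD)
qed

lemma (in pair_wf_digraph) dichromatic_number_props:
  shows "Card_order (dichromatic_number G)"
    and "chromatically_colourable G (dichromatic_number G)"
    and "\<And>\<kappa> :: 'a rel. \<lbrakk>Card_order \<kappa>; chromatically_colourable G \<kappa>\<rbrakk> \<Longrightarrow> dichromatic_number G \<le>o \<kappa>"
proof -
  let ?R = "{\<kappa> :: 'a rel. Card_order \<kappa> \<and> chromatically_colourable G \<kappa>}"
  have "chromatic_colouring G (Field |pverts G| ) (\<lambda>v. v)"
    using chromatic_colouring_inj[of "\<lambda>v. v"] by (simp add: Field_card_of)
  then have "|pverts G| \<in> ?R"
    by (auto simp: chromatically_colourable_def card_of_Card_order)
  then have "\<exists>\<kappa>\<in>?R. \<forall>\<kappa>'\<in>?R. \<kappa> \<le>o \<kappa>'"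
    by (intro exists_minim_Card_order) auto
  then have "\<exists>\<kappa> :: 'a rel. Card_order \<kappa> \<and> chromatically_colourable G \<kappa> \<and>
     (\<forall>\<kappa>' :: 'a rel. Card_order \<kappa>' \<and> chromatically_colourable G \<kappa>' \<longrightarrow> \<kappa> \<le>o \<kappa>')"
    by blast
  from someI_ex[OF this, folded dichromatic_number_def]
  show "Card_order (dichromatic_number G)"
    and "chromatically_colourable G (dichromatic_number G)"
    and "\<And>\<kappa> :: 'a rel. \<lbrakk>Card_order \<kappa>; chromatically_colourable G \<kappa>\<rbrakk> \<Longrightarrow> dichromatic_number G \<le>o \<kappa>"
    by auto
qed

lemma (in pair_wf_digraph) dichromatic_number_le:
  fixes \<kappa> :: "'k rel"
  assumes "Card_order \<kappa>" and "chromatically_colourable G \<kappa>"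
  shows "dichromatic_number G \<le>o \<kappa>"
proof -
  from assms(2) obtain c where c: "c \<in> pverts G \<rightarrow> Field \<kappa>"
    and nm: "\<And>p. directed_cycle G p \<Longrightarrow> \<not> monochromatic c p"
    by (auto simp: chromatically_colourable_def chromatic_colouring_def)
  define g where "g = inv_into (pverts G) c"
  have gc: "c (g (c v)) = c v" if "v \<in> pverts G" for v
    using that by (simp add: g_def f_inv_into_f)
  let ?A = "g ` c ` pverts G"
  have "chromatic_colouring G ?A (g \<circ> c)"
    unfolding chromatic_colouring_def
  proof (intro conjI allI impI notI)
    show "g \<circ> c \<in> pverts G \<rightarrow> ?A" by auto
    fix p assume p: "directed_cycle G p" and "monochromatic (g \<circ> c) p"
    then obtain k where k: "\<forall>e\<in>set p. g (c (fst e)) = k \<and> g (c (snd e)) = k"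
      by (auto simp: monochromatic_def)
    have sub: "set p \<subseteq> parcs G"
      using p by (auto simp: directed_cycle_def cycle_def awalk_def)
    have "c (fst e) = c k \<and> c (snd e) = c k" if "e \<in> set p" for e
      using k gc[of "fst e"] gc[of "snd e"] that sub arc_fst_in_verts[of e] arc_snd_in_verts[of e]
      by auto
    then have "monochromatic c p" by (auto simp: monochromatic_def)
    with nm[OF p] show False ..
  qed
  then have "dichromatic_number G \<le>o |?A|"
    by (intro dichromatic_number_props(3))
      (auto simp: chromatically_colourable_def card_of_card_order_on Field_card_of)
  also have "|?A| \<le>o |c ` pverts G|" by (rule card_of_image)
  also have "|c ` pverts G| \<le>o |Field \<kappa>|" using c by (intro card_of_mono1) auto
  also have "|Field \<kappa>| =o \<kappa>" using assms(1) by (rule card_of_Field_ordIso)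
  finally show ?thesis .
qed

end

theory Submission
  imports Defs
begin

text \<open>
  Take the product of finite cyclic groups \<open>\<int>/k\<^sub>0 \<times> \<int>/k\<^sub>1 \<times> \<dots>\<close> as vertex set and draw an arc from
  \<open>x\<close> to \<open>y\<close> if \<open>y\<^sub>m = x\<^sub>m + 1\<close> at the first coordinate \<open>m\<close> at which they differ. By the Baire
  category theorem, in every colouring with countably many colours some colour class is dense in a
  cylinder, and already the next coordinate then yields a monochromatic directed cycle. Conversely,
  if \<open>m\<close> is the first coordinate that is not constant along a given directed cycle, then the cycle
  runs through all \<open>k\<^sub>m\<close> values there. Hence in a subdigraph with few vertices only the
  first few coordinates, say \<open>l\<close> of them, matter, and recording which of these vanish is a
  chromatic colouring with \<open>2\<^sup>l\<close> colours. It remains to let \<open>k\<close> grow fast enough.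
\<close>

section \<open>The digraph on a product of cyclic groups\<close>

definition cyclic_box :: "(nat \<Rightarrow> nat) \<Rightarrow> (nat \<Rightarrow> nat) set" where
  "cyclic_box k = {x. \<forall>i. x i < k i}"

text \<open>These are the basic open sets of the product topology on the box.\<close>

definition cylinder :: "(nat \<Rightarrow> nat) \<Rightarrow> (nat \<Rightarrow> nat) \<Rightarrow> nat \<Rightarrow> (nat \<Rightarrow> nat) set" where
  "cylinder k x m = {y \<in> cyclic_box k. \<forall>i<m. y i = x i}"

definition cyclic_arc :: "(nat \<Rightarrow> nat) \<Rightarrow> (nat \<Rightarrow> nat) \<Rightarrow> (nat \<Rightarrow> nat) \<Rightarrow> bool" where
  "cyclic_arc k x y \<longleftrightarrow> (\<exists>m. (\<forall>i<m. x i = y i) \<and> x m \<noteq> y m \<and> y m = Suc (x m) mod k m)"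

text \<open>Labelling vertices by \<open>\<phi>\<close> allows any vertex type: in the theorem
  \<open>\<phi>\<close> is a bijection from \<open>nat set\<close> onto the box, so all of
  \<open>UNIV\<close> can serve as the vertex set.\<close>

definition cyclic_digraph :: "(nat \<Rightarrow> nat) \<Rightarrow> ('a \<Rightarrow> nat \<Rightarrow> nat) \<Rightarrow> 'a pair_pre_digraph" where
  "cyclic_digraph k \<phi> = \<lparr>pverts = UNIV, parcs = {(a, b). cyclic_arc k (\<phi> a) (\<phi> b)}\<rparr>"

lemma pair_loopfree_digraph_cyclic_digraph: "pair_loopfree_digraph (cyclic_digraph k \<phi>)"
proof
  fix e assume "e \<in> parcs (cyclic_digraph k \<phi>)"
  then have "cyclic_arc k (\<phi> (fst e)) (\<phi> (snd e))" by (auto simp: cyclic_digraph_def)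
  then show "fst e \<noteq> snd e" unfolding cyclic_arc_def by metis
qed (simp_all add: cyclic_digraph_def)

section \<open>Closed walks and potentials\<close>

lemma pcas_potential_mono:
  fixes h :: "'a \<Rightarrow> nat"
  assumes "pcas u p v" and "\<And>e. e \<in> set p \<Longrightarrow> h (fst e) \<le> h (snd e)"
  shows "h u \<le> h v"
  using assms
proof (induction p arbitrary: u)
  case Nil
  then show ?case by simp
next
  case (Cons e p)
  have "h (snd e) \<le> h v" using Cons by auto
  moreover have "h (fst e) \<le> h (snd e)" using Cons.prems(2) by simp
  ultimately show ?case using Cons.prems(1) by simp
qed

lemma pcas_append:
  "pcas u (p @ q) v \<longleftrightarrow> (\<exists>w. pcas u p w \<and> pcas w q v)"
  by (induction p arbitrary: u) auto

text \<open>Cutting the closed walk at \<open>e\<close> gives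
  \<open>h u \<le> h (fst e) \<le> h (snd e) \<le> h u\<close>.\<close>

lemma pcas_closed_potential_const:
  fixes h :: "'a \<Rightarrow> nat"
  assumes "pcas u p u" and mono: "\<And>e. e \<in> set p \<Longrightarrow> h (fst e) \<le> h (snd e)" and e: "e \<in> set p"
  shows "h (fst e) = h (snd e)"
proof -
  obtain q r where p: "p = q @ e # r" using e by (auto simp: in_set_conv_decomp)
  then have q: "pcas u q (fst e)" and r: "pcas (snd e) r u"
    using assms(1) by (auto simp: pcas_append)
  have "h u \<le> h (fst e)" by (rule pcas_potential_mono[OF q mono]) (simp add: p)
  moreover have "h (snd e) \<le> h u" by (rule pcas_potential_mono[OF r mono]) (simp add: p)
  moreover note mono[OF e]
  ultimately show ?thesis by simp
qed

text \<open>At the first coordinate \<open>m\<close> that moves, each arc keeps the value or adds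
  one cyclically. If a value \<open>w\<close> were missed, cutting the cyclic group at
  \<open>w\<close> would turn this into a nondecreasing integer, which must be constant on a closed
  walk.\<close>

lemma closed_walk_all_values:
  fixes \<phi> :: "'a \<Rightarrow> nat \<Rightarrow> nat"
  assumes box: "\<And>a. \<phi> a \<in> cyclic_box k"
    and walk: "pcas u p u" "p \<noteq> []"
    and arcs: "\<And>e. e \<in> set p \<Longrightarrow> cyclic_arc k (\<phi> (fst e)) (\<phi> (snd e))"
  shows "\<exists>m. \<forall>w<k m. \<exists>e\<in>set p. \<phi> (fst e) m = w \<or> \<phi> (snd e) m = w"
proof -
  let ?moves = "\<lambda>m. \<exists>e\<in>set p. \<phi> (fst e) m \<noteq> \<phi> (snd e) m"
  have "\<exists>m. ?moves m"
    using walk(2) arcs[of "hd p"] hd_in_set[of p] unfolding cyclic_arc_def by blast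
  then obtain m where m: "?moves m" and least: "\<And>i. i < m \<Longrightarrow> \<not> ?moves i"
    using exists_least_iff[of ?moves] by blast
  have step: "\<phi> (snd e) m = \<phi> (fst e) m \<or> \<phi> (snd e) m = Suc (\<phi> (fst e) m) mod k m"
    if e: "e \<in> set p" for e
  proof -
    obtain j where j: "\<forall>i<j. \<phi> (fst e) i = \<phi> (snd e) i" "\<phi> (fst e) j \<noteq> \<phi> (snd e) j"
      "\<phi> (snd e) j = Suc (\<phi> (fst e) j) mod k j"
      using arcs[OF e] by (auto simp: cyclic_arc_def)
    have "\<not> j < m" using least j(2) e by blast
    then show ?thesis using j(1,3) by (cases "j = m") auto
  qed
  have "\<exists>e\<in>set p. \<phi> (fst e) m = w \<or> \<phi> (snd e) m = w" if "w < k m" for w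
  proof (rule ccontr)
    assume "\<not> ?thesis"
    then have miss: "\<phi> (fst e) m \<noteq> w" "\<phi> (snd e) m \<noteq> w" if "e \<in> set p" for e
      using that by auto
    \<comment> \<open>Distance from the missed value, which a closed walk cannot decrease.\<close>
    define h where "h a = (if w < \<phi> a m then \<phi> a m - w else \<phi> a m + k m - w)" for a
    have h: "h (snd e) = h (fst e) \<or> h (snd e) = Suc (h (fst e))"
      and h_eq: "h (snd e) = h (fst e) \<Longrightarrow> \<phi> (snd e) m = \<phi> (fst e) m" if e: "e \<in> set p" for e
    proof -
      have lt: "\<phi> (fst e) m < k m" "\<phi> (snd e) m < k m"
        using box by (auto simp: cyclic_box_def)
      \<comment> \<open>The passage from \<open>k m - 1\<close> to \<open>0\<close> also raises
        \<open>h\<close> by one, because values below \<open>w\<close> are shifted by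
        \<open>k m\<close>.\<close>
      have "\<phi> (snd e) m = \<phi> (fst e) m \<or> h (snd e) = Suc (h (fst e))"
      proof (cases "Suc (\<phi> (fst e) m) = k m")
        case True
        then show ?thesis using step[OF e] miss[OF e] lt \<open>w < k m\<close> by (auto simp: h_def)
      next
        case False
        then show ?thesis using step[OF e] miss[OF e] lt \<open>w < k m\<close> by (auto simp: h_def)
      qed
      then show "h (snd e) = h (fst e) \<or> h (snd e) = Suc (h (fst e))"
        and "h (snd e) = h (fst e) \<Longrightarrow> \<phi> (snd e) m = \<phi> (fst e) m"
        by (auto simp: h_def)
    qed
    obtain e where e: "e \<in> set p" "\<phi> (fst e) m \<noteq> \<phi> (snd e) m" using m by blast
    have "h (fst e) = h (snd e)"
      by (rule pcas_closed_potential_const[OF walk(1) _ e(1)]) (use h in force)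
    then show False using h_eq e by metis
  qed
  then show ?thesis by blast
qed

section \<open>Baire category in the box\<close>

lemma cyclic_box_colour_dense_in_cylinder:
  fixes c :: "(nat \<Rightarrow> nat) \<Rightarrow> nat"
  assumes pos: "\<And>i. 0 < k i"
  shows "\<exists>j m. \<exists>x\<in>cyclic_box k. \<forall>n. \<forall>y\<in>cylinder k x m. \<exists>z\<in>cylinder k y n. c z = j"
proof (rule ccontr)
  assume "\<not> ?thesis"
  then have no: "\<exists>n. \<exists>y\<in>cylinder k x m. \<forall>z\<in>cylinder k y n. c z \<noteq> j"
    if "x \<in> cyclic_box k" for j x m
    using that by meson
  \<comment> \<open>A pair \<open>(y, n)\<close> stands for \<open>cylinder k y n\<close>. By
    \<open>no\<close>, the cylinder of stage \<open>j\<close> can be shrunk to one without colour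
    \<open>j\<close>; a point common to all stages then has no possible colour.\<close>
  define P :: "nat \<Rightarrow> (nat \<Rightarrow> nat) \<times> nat \<Rightarrow> bool"
    where "P j s \<longleftrightarrow> fst s \<in> cyclic_box k" for j s
  define Q :: "nat \<Rightarrow> (nat \<Rightarrow> nat) \<times> nat \<Rightarrow> (nat \<Rightarrow> nat) \<times> nat \<Rightarrow> bool"
    where "Q j s t \<longleftrightarrow> (\<forall>i<snd s. fst t i = fst s i) \<and> snd s < snd t \<and>
      (\<forall>z\<in>cylinder k (fst t) (snd t). c z \<noteq> j)" for j s t
  have "\<exists>t. P (Suc j) t \<and> Q j s t" if s: "P j s" for j s
  proof -
    obtain y n where "y \<in> cylinder k (fst s) (snd s)" "\<forall>z\<in>cylinder k y n. c z \<noteq> j"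
      using no[of "fst s" "snd s" j] s unfolding P_def by blast
    \<comment> \<open>Lengthening the prefix beyond \<open>snd s\<close> only shrinks the cylinder,
      and it makes the stages determine every coordinate in the limit.\<close>
    then show ?thesis
      by (intro exI[of _ "(y, max n (Suc (snd s)))"]) (auto simp: P_def Q_def cylinder_def)
  qed
  moreover have "P 0 (\<lambda>_. 0, 0)" using pos by (auto simp: P_def cyclic_box_def)
  ultimately obtain s where s: "\<And>j. P j (s j)" "\<And>j. Q j (s j) (s (Suc j))"
    using dependent_nat_choice[of P Q] by blast
  have len: "j \<le> snd (s j)" for j
  proof (induction j)
    case (Suc j)
    then show ?case using s(2)[of j] by (auto simp: Q_def)
  qed simp
  have agree: "fst (s j') i = fst (s j) i \<and> snd (s j) \<le> snd (s j')"
    if "j \<le> j'" "i < snd (s j)" for i j j'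
    using that
  proof (induction j' rule: dec_induct)
    case (step j')
    then show ?case using s(2)[of j'] by (auto simp: Q_def)
  qed simp
  \<comment> \<open>By \<open>len\<close>, stage \<open>Suc i\<close> has already fixed coordinate
    \<open>i\<close>.\<close>
  define z where "z i = fst (s (Suc i)) i" for i
  have z: "z i = fst (s j) i" if "i < snd (s j)" for i j
  proof (cases "Suc i \<le> j")
    case True
    then show ?thesis using agree[of "Suc i" j i] len[of "Suc i"] by (simp add: z_def)
  next
    case False
    then show ?thesis using agree[of j "Suc i" i] that by (simp add: z_def)
  qed
  have "z \<in> cyclic_box k" using s(1) by (auto simp: P_def cyclic_box_def z_def)
  \<comment> \<open>The step from stage \<open>c z\<close> to the next one removed the colour
    \<open>c z\<close>.\<close>
  then have "z \<in> cylinder k (fst (s (Suc (c z)))) (snd (s (Suc (c z))))"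
    using z by (auto simp: cylinder_def)
  then show False using s(2)[of "c z"] by (auto simp: Q_def)
qed

section \<open>Monochromatic cycles and the uncountable dichromatic number\<close>

lemma pcas_map_upt: "m \<le> n \<Longrightarrow> pcas (z m) (map (\<lambda>i. (z i, z (Suc i))) [m..<n]) (z n)"
  by (induction m rule: inc_induct) (simp_all add: upt_conv_Cons)

lemma pawalk_verts_map_upt:
  "m \<le> n \<Longrightarrow> pawalk_verts (z m) (map (\<lambda>i. (z i, z (Suc i))) [m..<n]) = map z [m..<Suc n]"
proof (induction m rule: inc_induct)
  case (step m)
  then show ?case by (simp add: upt_conv_Cons[of m] del: upt_Suc)
qed simp

lemma directed_cycle_map_upt:
  assumes "2 \<le> n" and inj: "inj_on y {..<n}" and "range y \<subseteq> pverts D"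
    and arcs: "\<And>i. i < n \<Longrightarrow> (y i, y (Suc i mod n)) \<in> parcs D"
  shows "directed_cycle D (map (\<lambda>i. (y i, y (Suc i mod n))) [0..<n])"
proof -
  let ?p = "map (\<lambda>i. (y i, y (Suc i mod n))) [0..<n]"
  \<comment> \<open>Unrolling the index modulo \<open>n\<close> turns the cycle into a linear walk
    of \<open>n\<close> steps from \<open>y 0\<close> back to \<open>y 0\<close>.\<close>
  define z where "z i = y (i mod n)" for i
  have p: "?p = map (\<lambda>i. (z i, z (Suc i))) [0..<n]" by (auto simp: z_def)
  have z0: "z 0 = y 0" "z n = y 0" by (auto simp: z_def)
  have "pcas (y 0) ?p (y 0)" using pcas_map_upt[of 0 n z] unfolding p z0 by simp
  moreover have "set ?p \<subseteq> parcs D" using arcs by auto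
  ultimately have "pre_digraph.awalk (with_proj D) (y 0) ?p (y 0)"
    using assms(3) by (auto simp: pre_digraph.awalk_def cas_with_proj_eq)
  moreover have "distinct (tl (pawalk_verts (y 0) ?p))"
  proof -
    have "pawalk_verts (y 0) ?p = map z [0..<Suc n]"
      using pawalk_verts_map_upt[of 0 n z] unfolding p z0 by simp
    then have "tl (pawalk_verts (y 0) ?p) = map z [1..<Suc n]"
      by (simp add: upt_conv_Cons del: upt_Suc)
    also have "\<dots> = map y [1..<n] @ [y 0]"
      using assms(1) by (auto simp: z_def)
    also have "distinct \<dots>"
      using inj_onD[OF inj, of 0] assms(1)
      by (fastforce simp: distinct_map intro!: inj_on_subset[OF inj])
    finally show ?thesis .
  qed
  ultimately show ?thesis
    using assms(1) unfolding directed_cycle_def pre_digraph.cycle_def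
    by (auto simp: awalk_verts_with_proj_eq)
qed

lemma natLeq_less_dichromatic_number_cyclic_digraph:
  fixes \<phi> :: "'a \<Rightarrow> nat \<Rightarrow> nat"
  assumes k: "\<And>i. 2 \<le> k i" and \<phi>: "bij_betw \<phi> UNIV (cyclic_box k)"
  shows "natLeq <o dichromatic_number (cyclic_digraph k \<phi>)"
proof (rule ccontr)
  let ?D = "cyclic_digraph k \<phi>"
  interpret pair_loopfree_digraph ?D by (rule pair_loopfree_digraph_cyclic_digraph)
  let ?\<kappa> = "dichromatic_number ?D"
  assume "\<not> ?thesis"
  then have "?\<kappa> \<le>o natLeq"
    using dichromatic_number_props(1) natLeq_Well_order not_ordLess_iff_ordLeq
    by (metis card_order_on_well_order_on)
  then have "|Field ?\<kappa>| \<le>o |UNIV :: nat set|"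
    using card_of_nat card_of_Field_ordIso[OF dichromatic_number_props(1)]
    by (meson ordIso_ordLeq_trans ordIso_symmetric ordLeq_ordIso_trans)
  then obtain g :: "'a \<Rightarrow> nat" where g: "inj_on g (Field ?\<kappa>)"
    by (auto simp: card_of_ordLeq[symmetric])
  obtain col where col: "col \<in> UNIV \<rightarrow> Field ?\<kappa>"
    "\<And>p. directed_cycle ?D p \<Longrightarrow> \<not> monochromatic col p"
    using dichromatic_number_props(2)
    unfolding chromatically_colourable_def chromatic_colouring_def
    by (auto simp: cyclic_digraph_def)
  have pos: "0 < k i" for i using k[of i] by simp
  obtain j x m where x: "x \<in> cyclic_box k" and
    dense: "\<And>y n. y \<in> cylinder k x m \<Longrightarrow> \<exists>z\<in>cylinder k y n. g (col (inv \<phi> z)) = j"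
    using cyclic_box_colour_dense_in_cylinder[of k "\<lambda>z. g (col (inv \<phi> z))"] pos by metis
  \<comment> \<open>Density is applied to the subcylinder that also fixes coordinate
    \<open>m\<close> to \<open>w mod k m\<close>. The coordinates after \<open>m\<close> are not
    controlled, but arcs between vertices that first differ at \<open>m\<close> do not depend on
    them, so the cases \<open>w < k m\<close> form a cycle of colour \<open>j\<close>.\<close>
  have "\<exists>a. (\<forall>i<m. \<phi> a i = x i) \<and> \<phi> a m = w mod k m \<and> g (col a) = j" for w
  proof -
    let ?y = "x(m := w mod k m)"
    have "?y \<in> cylinder k x m" using x pos by (auto simp: cyclic_box_def cylinder_def)
    then obtain z where "z \<in> cylinder k ?y (Suc m)" "g (col (inv \<phi> z)) = j"
      using dense by blast
    then have z: "z \<in> cyclic_box k" "\<forall>i<Suc m. z i = ?y i" "g (col (inv \<phi> z)) = j"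
      by (auto simp: cylinder_def)
    have "\<phi> (inv \<phi> z) = z"
      using z(1) \<phi> by (metis bij_betw_imp_surj_on f_inv_into_f)
    then show ?thesis using z(2,3) by (intro exI[of _ "inv \<phi> z"]) auto
  qed
  then obtain y where y: "\<And>w i. i < m \<Longrightarrow> \<phi> (y w) i = x i" "\<And>w. \<phi> (y w) m = w mod k m"
    "\<And>w. g (col (y w)) = j"
    by metis
  have arc: "(y w, y (Suc w mod k m)) \<in> parcs ?D" if w: "w < k m" for w
  proof -
    have "w \<noteq> Suc w mod k m"
      using w k[of m] by (cases "Suc w = k m") auto
    then show ?thesis
      using y w by (auto simp: cyclic_digraph_def cyclic_arc_def intro!: exI[of _ m])
  qed
  have "inj_on y {..<k m}"
    by (rule inj_onI) (metis lessThan_iff mod_less y(2))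
  then have "directed_cycle ?D (map (\<lambda>i. (y i, y (Suc i mod k m))) [0..<k m])"
    by (intro directed_cycle_map_upt k arc) (auto simp: cyclic_digraph_def)
  moreover have "col (y v) = col (y w)" for v w
    using col(1) y(3) by (intro inj_onD[OF g]) auto
  then have "monochromatic col (map (\<lambda>i. (y i, y (Suc i mod k m))) [0..<k m])"
    unfolding monochromatic_def by (intro exI[of _ "col (y 0)"]) auto
  ultimately show False using col(2) by blast
qed

section \<open>Colouring small subdigraphs\<close>

lemma chromatic_colouring_zero_pattern:
  fixes \<phi> :: "'a \<Rightarrow> nat \<Rightarrow> nat"
  assumes k: "\<And>i. 2 \<le> k i" and box: "\<And>a. \<phi> a \<in> cyclic_box k"
    and H: "pair_wf_digraph H" "parcs H \<subseteq> parcs (cyclic_digraph k \<phi>)" "finite (pverts H)"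
    and I: "\<And>m. k m \<le> card (pverts H) \<Longrightarrow> m \<in> I"
  shows "chromatic_colouring H (Pow I) (\<lambda>a. {i \<in> I. \<phi> a i = 0})"
  unfolding chromatic_colouring_def
proof (intro conjI allI impI notI)
  fix p assume "directed_cycle H p" and mono: "monochromatic (\<lambda>a. {i \<in> I. \<phi> a i = 0}) p"
  then obtain u where u: "pcas u p u" "p \<noteq> []" and sub: "set p \<subseteq> parcs H"
    by (auto simp: directed_cycle_def pre_digraph.cycle_def pre_digraph.awalk_def cas_with_proj_eq)
  have "cyclic_arc k (\<phi> (fst e)) (\<phi> (snd e))" if "e \<in> set p" for e
    using that sub H(2) by (auto simp: cyclic_digraph_def)
  from closed_walk_all_values[OF box u this] obtain m
    where m: "\<And>w. w < k m \<Longrightarrow> \<exists>e\<in>set p. \<phi> (fst e) m = w \<or> \<phi> (snd e) m = w"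
    by blast
  have verts: "fst e \<in> pverts H" "snd e \<in> pverts H" if "e \<in> set p" for e
    using that sub H(1) unfolding pair_wf_digraph_def by blast+
  \<comment> \<open>All \<open>k m\<close> values at coordinate \<open>m\<close> occur on vertices
    of \<open>H\<close>, so \<open>H\<close> is large enough to force \<open>m\<close> into
    \<open>I\<close>.\<close>
  have "{..<k m} \<subseteq> (\<lambda>a. \<phi> a m) ` pverts H"
    using m verts by fastforce
  then have "card {..<k m} \<le> card (pverts H)"
    by (rule surj_card_le[OF H(3)])
  then have mI: "m \<in> I" using I by simp
  obtain C where C: "\<forall>e\<in>set p. {i \<in> I. \<phi> (fst e) i = 0} = C \<and> {i \<in> I. \<phi> (snd e) i = 0} = C"
    using mono unfolding monochromatic_def by (elim exE)
  \<comment> \<open>As \<open>k m \<ge> 2\<close>, both \<open>0\<close> and \<open>1\<close> occur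
    at coordinate \<open>m\<close> along the cycle, and the zero pattern separates them.\<close>
  obtain e where e: "e \<in> set p" "\<phi> (fst e) m = 0 \<or> \<phi> (snd e) m = 0"
    using m[of 0] k[of m] by auto
  obtain e' where e': "e' \<in> set p" "\<phi> (fst e') m = 1 \<or> \<phi> (snd e') m = 1"
    using m[of 1] k[of m] by auto
  have zero_iff: "m \<in> C \<longleftrightarrow> \<phi> (fst d) m = 0" "m \<in> C \<longleftrightarrow> \<phi> (snd d) m = 0" if "d \<in> set p" for d
    using bspec[OF C that] mI by auto
  have "m \<in> C" using zero_iff[OF e(1)] e(2) by simp
  moreover have "m \<notin> C" using zero_iff[OF e'(1)] e'(2) by (metis zero_neq_one)
  ultimately show False by blast
qed auto

section \<open>Cardinality of the vertex set\<close>

lemma card_of_nat_set: "|UNIV :: nat set set| =o ctwo ^c natLeq"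
  using card_of_Pow_Func[of "UNIV :: nat set"]
  by (simp add: cexp_def ctwo_def Field_natLeq Field_card_of)

text \<open>Schroeder-Bernstein: indicator sequences lie in the box since
  \<open>k i \<ge> 2\<close>, and conversely a sequence is encoded by its graph under
  \<open>prod_encode\<close>.\<close>

lemma bij_betw_nat_set_cyclic_box:
  assumes k: "\<And>i. 2 \<le> k i"
  obtains \<phi> :: "nat set \<Rightarrow> nat \<Rightarrow> nat" where "bij_betw \<phi> UNIV (cyclic_box k)"
proof -
  have "inj_on (\<lambda>A i. of_bool (i \<in> A)) (UNIV :: nat set set)"
    by (auto simp: inj_on_def fun_eq_iff of_bool_eq_iff)
  moreover have "(\<lambda>A i. of_bool (i \<in> A)) ` (UNIV :: nat set set) \<subseteq> cyclic_box k"
  proof -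
    have "of_bool b < k i" for b i using k[of i] by (cases b) auto
    then show ?thesis by (auto simp: cyclic_box_def)
  qed
  moreover have "inj_on (\<lambda>x. range (\<lambda>i. prod_encode (i, x i))) (cyclic_box k)"
  proof (rule inj_onI, rule ext)
    fix x y :: "nat \<Rightarrow> nat" and i
    assume "range (\<lambda>i. prod_encode (i, x i)) = range (\<lambda>i. prod_encode (i, y i))"
    then have "prod_encode (i, x i) \<in> range (\<lambda>i. prod_encode (i, y i))" by blast
    then show "x i = y i" by auto
  qed
  ultimately show thesis using that Schroeder_Bernstein[of _ UNIV "cyclic_box k"] by blast
qed

section \<open>Counting colours and choosing the moduli\<close>

lemma card_of_ordLeq_iff_card_le:
  assumes "finite A" "finite B"
  shows "|A| \<le>o |B| \<longleftrightarrow> card A \<le> card B"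
  using assms by (simp add: card_of_ordLeq[symmetric] inj_on_iff_card_le)

lemma finite_power_two_less: "finite {i. 2 ^ Suc i < (n :: nat)}"
proof (rule finite_subset)
  show "{i. 2 ^ Suc i < n} \<subseteq> {..<n}"
    using less_exp less_trans Suc_lessD by blast
qed simp

text \<open>If \<open>M\<close> is the maximum of the set, it has at most \<open>M + 1\<close>
  elements and \<open>2 ^ (M + 1) < n\<close>. If the set is empty, the power is \<open>1\<close>,
  which \<open>n + 1\<close> covers even for \<open>n = 0\<close>. Hence zero patterns on these
  coordinates use fewer than \<open>n + 2\<close> colours.\<close>

lemma power_two_card_le: "2 ^ card {i. 2 ^ Suc i < n} \<le> n + (1 :: nat)"
proof (cases "{i. 2 ^ Suc i < n} = {}")
  case False
  let ?I = "{i. 2 ^ Suc i < n}"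
  note fin = finite_power_two_less[of n]
  then have "?I \<subseteq> {..Max ?I}" by auto
  then have "card ?I \<le> Suc (Max ?I)" using card_mono[of "{..Max ?I}"] by simp
  then have "(2 :: nat) ^ card ?I \<le> 2 ^ Suc (Max ?I)" by (intro power_increasing) auto
  also have "\<dots> < n" using Max_in[OF fin False] by simp
  finally show ?thesis by simp
qed simp

theorem theorem1p2:
  fixes f :: "nat \<Rightarrow> nat"
  shows "\<exists>D :: nat set pair_pre_digraph.
    pair_loopfree_digraph D \<and>
    |pverts D| =o ctwo ^c natLeq \<and>
    natLeq <o dichromatic_number D \<and>
    (\<forall>n. \<forall>H :: nat set pair_pre_digraph.
      subgraph (with_proj H) (with_proj D) \<and> dichromatic_number H =o |{..<n + 2}| \<longrightarrow>
      |{..<f n}| \<le>o |pverts H| )"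
proof -
  \<comment> \<open>\<open>g\<close> is a monotone majorant of \<open>f\<close>, so
    \<open>k i \<ge> f n\<close> whenever \<open>n \<le> 2 ^ Suc i\<close>. With fewer than
    \<open>f n\<close> vertices, only coordinates \<open>i\<close> with \<open>2 ^ Suc i < n\<close>
    can run through all their values.\<close>
  define g where "g n = (\<Sum>i\<le>n. f i)" for n
  define k where "k i = max 2 (g (2 ^ Suc i))" for i
  have k: "2 \<le> k i" for i by (simp add: k_def)
  obtain \<phi> :: "nat set \<Rightarrow> nat \<Rightarrow> nat" where \<phi>: "bij_betw \<phi> UNIV (cyclic_box k)"
    using bij_betw_nat_set_cyclic_box[of k] k by blast
  have box: "\<phi> a \<in> cyclic_box k" for a using \<phi> by (auto simp: bij_betw_def)
  let ?D = "cyclic_digraph k \<phi>"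
  have "|{..<f n}| \<le>o |pverts H|"
    if sub: "subgraph (with_proj H) (with_proj ?D)" and chi: "dichromatic_number H =o |{..<n + 2}|"
    for n and H :: "nat set pair_pre_digraph"
  proof (rule ccontr)
    assume contra: "\<not> ?thesis"
    then have less: "|pverts H| <o |{..<f n}|"
      by (rule not_ordLeq_iff_ordLess[OF card_of_Well_order card_of_Well_order, THEN iffD1])
    then have fin: "finite (pverts H)"
      using card_of_ordLeq_finite ordLess_imp_ordLeq by blast
    then have card: "card (pverts H) < f n"
      using contra by (simp add: card_of_ordLeq_iff_card_le)
    have H: "pair_wf_digraph H" "parcs H \<subseteq> parcs ?D"
      using sub by (auto simp: subgraph_def wf_digraph_wp_iff)
    interpret pair_wf_digraph H by (rule H(1))
    let ?I = "{i. 2 ^ Suc i < n}"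
    have "m \<in> ?I" if "k m \<le> card (pverts H)" for m
    proof (rule ccontr)
      assume "m \<notin> ?I"
      then have "f n \<le> g (2 ^ Suc m)"
        unfolding g_def by (intro member_le_sum) auto
      then show False using that card by (simp add: k_def)
    qed
    then have "chromatic_colouring H (Pow ?I) (\<lambda>a. {i \<in> ?I. \<phi> a i = 0})"
      using k box H fin by (intro chromatic_colouring_zero_pattern)
    then have "chromatically_colourable H |Pow ?I|"
      by (auto simp: chromatically_colourable_def Field_card_of)
    then have "dichromatic_number H \<le>o |Pow ?I|"
      by (intro dichromatic_number_le card_of_Card_order)
    then have "|{..<n + 2}| \<le>o |Pow ?I|"
      using chi ordIso_symmetric ordIso_ordLeq_trans by blast
    then have "n + 2 \<le> card (Pow ?I)"
      using finite_power_two_less[of n] by (simp add: card_of_ordLeq_iff_card_le)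
    also have "\<dots> \<le> n + 1"
      using power_two_card_le[of n] finite_power_two_less[of n] by (simp add: card_Pow)
    finally show False by simp
  qed
  moreover have "|pverts ?D| =o ctwo ^c natLeq"
    using card_of_nat_set by (simp add: cyclic_digraph_def)
  ultimately show ?thesis
    using pair_loopfree_digraph_cyclic_digraph natLeq_less_dichromatic_number_cyclic_digraph[OF k \<phi>]
    by (intro exI[of _ ?D]) blast
qed

end
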